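(* Let $X$ be a real Banach space that is strictly convex and smooth, let $1<p<\infty$ with Hölder conjugate $p^*$ (i.e. $1/p+1/p^*=1$), let $\varepsilon>0$, and let $f,g\in\Gamma_0(X)$. Then the following two statements are equivalent: (i) $f=g_\varepsilon$, i.e. $f$ is the $p$-Moreau--Yosida regularization of $g$: $f(x)=\inf\{\,g(y)+\frac{1}{p\varepsilon}\|x-y\|^p \mid y\in X\,\}$ for all $x\in X$; (ii) $f^*=g^*+\varepsilon^{p^*-1}\phi_{p^*}$ on $X^*$, where $\phi_{p^*}(x^* )=\|x^*\|^{p^*}/p^*$ for $x^*\in X^*$. If, in addition, $X$ is $p$-smooth (with $p\le 2$), then (i) (equivalently (ii)) implies: (iii) $\partial f^*$ is strongly $p^*$-monotone, i.e. there is a constant $c>0$ such that for all $x^*,y^*\in X^*$ with $\partial f^*(x^* )$ and $\partial f^*(y^* )$ non-empty, and all $x\in\partial f^*(x^* )$, $y\in\partial f^*(y^* )$, $$\langle x^*-y^*,x-y\rangle\ \ge\ c\,\|x^*-y^*\|^{p^*}.$$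
   Context: $X$ is a real Banach space with topological dual $X^*$; $\langle x^*,x\rangle=x^*(x)$ is the dual pairing; $\|\cdot\|$ denotes the norm on both $X$ and $X^*$. $X$ is strictly convex if $\frac12\|x+y\|<1$ whenever $\|x\|=\|y\|=1$, $x\ne y$. $X$ is smooth if for every $x\in X$ with $\|x\|=1$ there is exactly one $x^*\in X^*$ with $\langle x^*,x\rangle=\|x^*\|=1$. The modulus of smoothness of $X$ is $\rho_X(\tau)=\sup\{\frac12(\|x+y\|+\|x-y\|)-1 \mid x,y\in X,\ \|x\|=1,\ \|y\|=\tau\}$ for $\tau\ge0$. For $p>1$, $X$ is $p$-smooth if there is $C>0$ with $\rho_X(\tau)\le C\tau^p$ for all $\tau\ge 0$ (such a space is uniformly smooth, hence reflexive). $\Gamma_0(X)$ is the set of convex, lower semicontinuous functions $X\to\mathbb{R}\cup\{+\infty\}$ that are proper, i.e. not identically $+\infty$. The convex conjugate of $f$ is $f^*(x^* )=\sup\{\langle x^*,x\rangle-f(x)\mid x\in X\}$ for $x^*\in X^*$. In (iii), where $X$ is reflexive and $X^{**}$ is identified with $X$, the subdifferential of $f^*$ at $x^*\in X^*$ is $\partial f^*(x^* )=\{x\in X\mid \forall y^*\in X^*:\ f^*(x^* )-f^*(y^* )\le\langle x^*-y^*,x\rangle\}$. *)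

theory Defs
  imports "HOL-Analysis.Analysis"
begin

text \<open>
  The topological dual of \<open>'a\<close> is the type \<open>'a \<Rightarrow>\<^sub>L real\<close> of bounded linear functionals,
  whose norm is the operator norm; the pairing is \<^const>\<open>blinfun_apply\<close>.
\<close>

definition strictly_convex_space :: "'a::real_normed_vector itself \<Rightarrow> bool" where
  "strictly_convex_space (_ :: 'a itself) \<longleftrightarrow>
     (\<forall>x y :: 'a. norm x = 1 \<longrightarrow> norm y = 1 \<longrightarrow> x \<noteq> y \<longrightarrow> 1/2 * norm (x + y) < 1)"

definition smooth_space :: "'a::real_normed_vector itself \<Rightarrow> bool" where
  "smooth_space (_ :: 'a itself) \<longleftrightarrow>
     (\<forall>x :: 'a. norm x = 1 \<longrightarrow> (\<exists>!x' :: 'a \<Rightarrow>\<^sub>L real. blinfun_apply x' x = 1 \<and> norm x' = 1))"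

definition modulus_of_smoothness :: "'a::real_normed_vector itself \<Rightarrow> real \<Rightarrow> ereal" where
  "modulus_of_smoothness (_ :: 'a itself) \<tau> =
     Sup {ereal (1/2 * (norm (x + y) + norm (x - y)) - 1) | x y :: 'a. norm x = 1 \<and> norm y = \<tau>}"

definition p_smooth_space :: "'a::real_normed_vector itself \<Rightarrow> real \<Rightarrow> bool" where
  "p_smooth_space X p \<longleftrightarrow>
     (\<exists>C>0. \<forall>\<tau>\<ge>0. modulus_of_smoothness X \<tau> \<le> ereal (C * \<tau> powr p))"

definition ereal_convex :: "('a::real_vector \<Rightarrow> ereal) \<Rightarrow> bool" where
  "ereal_convex f \<longleftrightarrow>
     (\<forall>x y. \<forall>t\<in>{0..1}. f ((1 - t) *\<^sub>R x + t *\<^sub>R y) \<le> ereal (1 - t) * f x + ereal t * f y)"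

definition lower_semicontinuous :: "('a::topological_space \<Rightarrow> ereal) \<Rightarrow> bool" where
  "lower_semicontinuous f \<longleftrightarrow> (\<forall>x. f x \<le> Liminf (at x) f)"

definition Gamma0 :: "('a::real_normed_vector \<Rightarrow> ereal) set" where
  "Gamma0 = {f. (\<forall>x. f x \<noteq> -\<infinity>) \<and> (\<exists>x. f x \<noteq> \<infinity>) \<and> ereal_convex f \<and> lower_semicontinuous f}"

definition convex_conjugate :: "('a::real_normed_vector \<Rightarrow> ereal) \<Rightarrow> ('a \<Rightarrow>\<^sub>L real) \<Rightarrow> ereal" where
  "convex_conjugate f x' = (SUP x. ereal (blinfun_apply x' x) - f x)"

definition moreau_yosida ::
    "real \<Rightarrow> real \<Rightarrow> ('a::real_normed_vector \<Rightarrow> ereal) \<Rightarrow> 'a \<Rightarrow> ereal" where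
  "moreau_yosida p \<epsilon> g x = (INF y. g y + ereal (1 / (p * \<epsilon>) * norm (x - y) powr p))"

definition phi :: "real \<Rightarrow> 'b::real_normed_vector \<Rightarrow> real" where
  "phi r z = norm z powr r / r"

text \<open>
  The subdifferential, as a subset of \<open>'a\<close>, of a function on the dual.  Since
  \<open>\<infinity> - \<infinity> = \<infinity>\<close> in \<^typ>\<open>ereal\<close>, it is empty wherever \<open>F\<close> takes the value \<open>\<infinity>\<close>.
\<close>

definition dual_subdifferential ::
    "(('a::real_normed_vector \<Rightarrow>\<^sub>L real) \<Rightarrow> ereal) \<Rightarrow> ('a \<Rightarrow>\<^sub>L real) \<Rightarrow> 'a set" where
  "dual_subdifferential F x' = {x. \<forall>y'. F x' - F y' \<le> ereal (blinfun_apply (x' - y') x)}"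

definition strongly_monotone ::
    "real \<Rightarrow> (('a::real_normed_vector \<Rightarrow>\<^sub>L real) \<Rightarrow> 'a set) \<Rightarrow> bool" where
  "strongly_monotone r A \<longleftrightarrow>
     (\<exists>c>0. \<forall>x' y'. A x' \<noteq> {} \<longrightarrow> A y' \<noteq> {} \<longrightarrow>
        (\<forall>x\<in>A x'. \<forall>y\<in>A y'. blinfun_apply (x' - y') (x - y) \<ge> c * norm (x' - y') powr r))"

end

theory Submission
  imports Defs
begin

text \<open>
  \<open>g\<^sub>\<epsilon>\<close> is the infimal convolution of \<open>g\<close> with \<open>h = \<parallel>\<cdot>\<parallel>\<^sup>p / (p \<epsilon>)\<close>. Conjugation turns infimal
  convolutions into sums and \<open>h\<^sup>*\<close> is \<open>\<epsilon>\<^bsup>q-1\<^esup> \<phi>\<^sub>q\<close>, so (ii) says \<open>f\<^sup>* = g\<^sub>\<epsilon>\<^sup>*\<close>; since \<open>f\<close> and \<open>g\<^sub>\<epsilon>\<close> both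
  equal their biconjugates, this is (i). If the space is \<open>p\<close>-smooth, then
  \<open>h (u + v) + h (u - v) \<le> 2 h u + K \<parallel>v\<parallel>\<^sup>p\<close>; this bound passes to \<open>g\<^sub>\<epsilon>\<close> by evaluating at an almost
  optimal \<open>y\<close>, and dualizes to strong monotonicity of \<open>\<partial>f\<^sup>*\<close> with exponent \<open>q\<close>.
\<close>

subsection \<open>Subgradients\<close>

text \<open>An infimum of convex functions need not be convex; \<open>comb\<close> supplies what
  joint convexity in index and point would give. Near-minimizers \<open>i\<close> at
  \<open>x\<close> and \<open>j\<close> at \<open>y\<close> combine into a competitor
  \<open>k\<close> at the convex combination. Used for chains in Zorn's lemma, for the auxiliary
  \<open>Q\<close>, and for infimal convolutions.\<close>

lemma convex_on_INF:
  fixes F :: "'i \<Rightarrow> 'a::real_vector \<Rightarrow> real"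
  assumes ne: "I \<noteq> {}"
    and bdd: "\<And>x. bdd_below ((\<lambda>i. F i x) ` I)"
    and comb: "\<And>i j x y t. \<lbrakk>i \<in> I; j \<in> I; 0 < t; t < 1\<rbrakk> \<Longrightarrow>
      \<exists>k\<in>I. F k ((1 - t) *\<^sub>R x + t *\<^sub>R y) \<le> (1 - t) * F i x + t * F j y"
  shows "convex_on UNIV (\<lambda>x. INF i\<in>I. F i x)"
proof (rule convex_onI)
  fix t :: real and x y :: 'a
  assume t: "t > 0" "t < 1"
  show "(INF i\<in>I. F i ((1 - t) *\<^sub>R x + t *\<^sub>R y)) \<le> (1 - t) * (INF i\<in>I. F i x) + t * (INF i\<in>I. F i y)"
    (is "?L \<le> (1 - t) * ?X + t * ?Y")
  proof (rule field_le_epsilon)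
    fix e :: real assume e: "e > 0"
    obtain i where i: "i \<in> I" "F i x < ?X + e"
      using cINF_less_iff[OF ne bdd, of x "?X + e"] e by auto
    obtain j where j: "j \<in> I" "F j y < ?Y + e"
      using cINF_less_iff[OF ne bdd, of y "?Y + e"] e by auto
    obtain k where k: "k \<in> I" "F k ((1 - t) *\<^sub>R x + t *\<^sub>R y) \<le> (1 - t) * F i x + t * F j y"
      using comb[OF i(1) j(1) t] by blast
    have "?L \<le> F k ((1 - t) *\<^sub>R x + t *\<^sub>R y)"
      by (rule cINF_lower[OF bdd k(1)])
    also have "\<dots> \<le> (1 - t) * F i x + t * F j y" by (rule k)
    also have "\<dots> \<le> (1 - t) * (?X + e) + t * (?Y + e)"
      using i j t by (intro add_mono mult_left_mono) auto
    also have "\<dots> = (1 - t) * ?X + t * ?Y + e" by (simp add: algebra_simps)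
    finally show "?L \<le> (1 - t) * ?X + t * ?Y + e" .
  qed
qed simp

text \<open>Convexity at \<open>0\<close>, the midpoint of \<open>x\<close> and \<open>- x\<close>.
  It turns an upper bound on \<open>Q\<close> into a lower one, which keeps infima over chains
  finite.\<close>

lemma convex_on_UNIV_neg_le:
  fixes Q :: "'a::real_vector \<Rightarrow> real"
  assumes "convex_on UNIV Q" "Q 0 = 0"
  shows "- Q (- x) \<le> Q x"
  using convex_onD[OF assms(1), of "1/2" x "-x"] assms(2) by (simp add: scaleR_right_distrib[symmetric])

text \<open>
  A Hahn--Banach theorem. Among the convex functions below \<open>P\<close> that vanish at \<open>0\<close>, a pointwise
  minimal one \<open>m\<close> is linear: it coincides with \<open>x \<mapsto> m (s x) / s\<close> for \<open>0 < s \<le> 1\<close>, which makes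
  it sublinear, and then with \<open>x \<mapsto> INF t \<ge> 0. m (x + t a) - t (m a)\<close>, which makes it additive.
\<close>

lemma convex_linear_minorant:
  fixes P :: "'a::real_vector \<Rightarrow> real"
  assumes P: "convex_on UNIV P" "P 0 = 0"
  obtains l where "linear l" "\<And>x. l x \<le> P x"
proof -
  define A where "A = {Q. convex_on UNIV Q \<and> Q 0 = 0 \<and> (\<forall>x. Q x \<le> P x)}"
  \<comment> \<open>The order is reversed, so that a maximal element in Zorn's lemma is a pointwise
    minimal function.\<close>
  define R where "R = (\<lambda>Q Q' :: 'a \<Rightarrow> real. \<forall>x. Q' x \<le> Q x)"
  have "partial_order_on A (relation_of R A)"
    by (rule partial_order_on_relation_ofI) (auto simp: R_def fun_eq_iff intro: order_trans order_antisym)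
  moreover have "\<exists>u\<in>A. \<forall>Q\<in>C. R Q u" if C: "C \<in> Chains (relation_of R A)" for C
  proof (cases "C = {}")
    case True
    with P show ?thesis by (auto simp: A_def intro!: bexI[of _ P])
  next
    case False
    have CA: "C \<subseteq> A" by (rule Chains_relation_of[OF C])
    have tot: "R Q Q' \<or> R Q' Q" if "Q \<in> C" "Q' \<in> C" for Q Q'
      using C that by (auto simp: Chains_def relation_of_def)
    define u where "u = (\<lambda>x. INF Q\<in>C. Q x)"
    have bdd: "bdd_below ((\<lambda>Q. Q x) ` C)" for x
    proof (rule bdd_belowI2)
      fix Q assume "Q \<in> C"
      then have "convex_on UNIV Q" "Q 0 = 0" "Q (- x) \<le> P (- x)" using CA by (auto simp: A_def)
      with convex_on_UNIV_neg_le[of Q x] show "- P (- x) \<le> Q x" by linarith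
    qed
    have "convex_on UNIV u"
      unfolding u_def
    proof (rule convex_on_INF[OF False bdd])
      fix Q Q' and x y :: 'a and t :: real
      assume Q: "Q \<in> C" "Q' \<in> C" and t: "0 < t" "t < 1"
      \<comment> \<open>The smaller of the two comparable functions lies below both, and its own
        convexity suffices.\<close>
      from tot[OF Q] obtain K where K: "K \<in> C" "\<And>z. K z \<le> Q z" "\<And>z. K z \<le> Q' z"
        using Q unfolding R_def by (metis order_refl)
      then have "K ((1 - t) *\<^sub>R x + t *\<^sub>R y) \<le> (1 - t) * K x + t * K y"
        using CA t by (intro convex_onD[of UNIV]) (auto simp: A_def)
      also have "\<dots> \<le> (1 - t) * Q x + t * Q' y"
        using K t by (intro add_mono mult_left_mono) auto
      finally show "\<exists>k\<in>C. k ((1 - t) *\<^sub>R x + t *\<^sub>R y) \<le> (1 - t) * Q x + t * Q' y"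
        using K(1) by blast
    qed
    moreover have "u 0 = 0"
    proof -
      have "Q 0 = 0" if "Q \<in> C" for Q using CA that by (auto simp: A_def)
      then have "u 0 = (INF Q\<in>C. 0)" unfolding u_def by (intro INF_cong refl)
      then show ?thesis using False by simp
    qed
    moreover have low: "u x \<le> Q x" if "Q \<in> C" for Q x
      unfolding u_def by (rule cINF_lower[OF bdd that])
    moreover have "u x \<le> P x" for x
    proof -
      obtain Q where "Q \<in> C" using False by blast
      with low[of Q x] CA have "u x \<le> Q x" "Q x \<le> P x" by (auto simp: A_def)
      then show ?thesis by linarith
    qed
    ultimately show ?thesis by (auto simp: A_def R_def intro!: bexI[of _ u])
  qed
  ultimately obtain m where "m \<in> A" and min: "\<And>Q. Q \<in> A \<Longrightarrow> R m Q \<Longrightarrow> Q = m"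
    using predicate_Zorn[of A R] by blast
  then have m: "convex_on UNIV m" "m 0 = 0" "\<And>x. m x \<le> P x" by (auto simp: A_def)
  have minimal: "Q x = m x" if "convex_on UNIV Q" "Q 0 = 0" "\<And>x. Q x \<le> m x" for Q x
  proof -
    have "Q y \<le> P y" for y using that(3)[of y] m(3)[of y] by linarith
    with that have "Q = m" by (intro min) (auto simp: A_def R_def)
    then show ?thesis by simp
  qed
  have hom1: "m (s *\<^sub>R x) = s * m x" if s: "0 < s" "s \<le> 1" for s x
  proof -
    \<comment> \<open>This function lies below \<open>m\<close> by convexity between
      \<open>0\<close> and \<open>x\<close>, so minimality forces equality.\<close>
    have "convex_on UNIV (\<lambda>x. m (s *\<^sub>R x) / s)"
    proof (rule convex_onI)
      fix t :: real and x y :: 'a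
      assume "t > 0" "t < 1"
      then have "m ((1 - t) *\<^sub>R (s *\<^sub>R x) + t *\<^sub>R (s *\<^sub>R y)) \<le> (1 - t) * m (s *\<^sub>R x) + t * m (s *\<^sub>R y)"
        by (intro convex_onD[OF m(1)]) auto
      then have "m (s *\<^sub>R ((1 - t) *\<^sub>R x + t *\<^sub>R y)) \<le> (1 - t) * m (s *\<^sub>R x) + t * m (s *\<^sub>R y)"
        by (simp add: scaleR_right_distrib mult.commute)
      then have "m (s *\<^sub>R ((1 - t) *\<^sub>R x + t *\<^sub>R y)) / s \<le> ((1 - t) * m (s *\<^sub>R x) + t * m (s *\<^sub>R y)) / s"
        using s by (intro divide_right_mono) auto
      then show "m (s *\<^sub>R ((1 - t) *\<^sub>R x + t *\<^sub>R y)) / s \<le> (1 - t) * (m (s *\<^sub>R x) / s) + t * (m (s *\<^sub>R y) / s)"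
        by (simp add: add_divide_distrib)
    qed simp
    moreover have "m (s *\<^sub>R x) / s \<le> m x" for x
      using convex_onD[OF m(1), of s 0 x] s m(2) by (simp add: field_simps)
    ultimately have "m (s *\<^sub>R x) / s = m x" using m(2) by (intro minimal) auto
    then show ?thesis using s by (simp add: field_simps)
  qed
  have hom: "m (s *\<^sub>R x) = s * m x" if s: "s \<ge> 0" for s x
  proof -
    consider "s = 0" | "0 < s" "s \<le> 1" | "s > 1" using s by linarith
    then show ?thesis
    proof cases
      case 3
      with hom1[of "1/s" "s *\<^sub>R x"] show ?thesis by (simp add: field_simps)
    qed (auto simp: m hom1)
  qed
  have sub: "m (x + y) \<le> m x + m y" for x y
    using convex_onD[OF m(1), of "1/2" x y] hom[of "1/2" "x + y"]
    by (simp add: scaleR_right_distrib)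
  have sup: "m x + m a \<le> m (x + a)" for x a
  proof -
    define Q where "Q = (\<lambda>x. INF t\<in>{0..}. m (x + t *\<^sub>R a) - t * m a)"
    have bdd: "bdd_below ((\<lambda>t. m (x + t *\<^sub>R a) - t * m a) ` {0..})" for x
    proof (rule bdd_belowI2)
      fix t :: real assume "t \<in> {0..}"
      \<comment> \<open>Subadditivity for \<open>x + t a\<close> and \<open>- x\<close> bounds
        \<open>t * m a = m (t a)\<close>.\<close>
      with hom[of t a] sub[of "x + t *\<^sub>R a" "- x"] show "- m (- x) \<le> m (x + t *\<^sub>R a) - t * m a" by simp
    qed
    have "convex_on UNIV Q"
      unfolding Q_def
    proof (rule convex_on_INF[OF _ bdd])
      fix i j t :: real and x y :: 'a
      assume ij: "i \<in> {0..}" "j \<in> {0..}" and t: "0 < t" "t < 1"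
      define k where "k = (1 - t) * i + t * j"
      have "m ((1 - t) *\<^sub>R (x + i *\<^sub>R a) + t *\<^sub>R (y + j *\<^sub>R a)) \<le> (1 - t) * m (x + i *\<^sub>R a) + t * m (y + j *\<^sub>R a)"
        using t by (intro convex_onD[OF m(1)]) auto
      moreover have "(1 - t) *\<^sub>R (x + i *\<^sub>R a) + t *\<^sub>R (y + j *\<^sub>R a) = (1 - t) *\<^sub>R x + t *\<^sub>R y + k *\<^sub>R a"
        by (simp add: k_def algebra_simps)
      ultimately have "m ((1 - t) *\<^sub>R x + t *\<^sub>R y + k *\<^sub>R a) - k * m a
          \<le> (1 - t) * (m (x + i *\<^sub>R a) - i * m a) + t * (m (y + j *\<^sub>R a) - j * m a)"
        by (simp add: k_def algebra_simps)
      moreover have "k \<in> {0..}" using ij t by (simp add: k_def)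
      ultimately show "\<exists>k\<in>{0..}. m ((1 - t) *\<^sub>R x + t *\<^sub>R y + k *\<^sub>R a) - k * m a
          \<le> (1 - t) * (m (x + i *\<^sub>R a) - i * m a) + t * (m (y + j *\<^sub>R a) - j * m a)"
        by blast
    qed simp
    moreover have "Q 0 = 0"
    proof -
      have "m (0 + t *\<^sub>R a) - t * m a = 0" if "t \<in> {0..}" for t using hom that by simp
      then have "Q 0 = (INF t\<in>{0::real..}. 0)" unfolding Q_def by (intro INF_cong refl)
      then show ?thesis by simp
    qed
    moreover have low: "Q x \<le> m (x + t *\<^sub>R a) - t * m a" if "t \<ge> 0" for x t
      unfolding Q_def using that by (intro cINF_lower[OF bdd]) auto
    moreover have "Q x \<le> m x" for x using low[of 0 x] by simp
    ultimately have "Q x = m x" by (intro minimal) auto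
    \<comment> \<open>The choice \<open>t = 1\<close> in the infimum turns \<open>Q x = m x\<close>
      into superadditivity.\<close>
    with low[of 1 x] show ?thesis by simp
  qed
  have add: "m (x + y) = m x + m y" for x y using sub sup by (intro antisym) auto
  have neg: "m (- x) = - m x" for x using add[of x "- x"] m(2) by simp
  have "linear m"
  proof (rule linearI)
    fix r :: real and x
    show "m (r *\<^sub>R x) = r *\<^sub>R m x"
      using hom[of r x] hom[of "- r" x] neg[of "r *\<^sub>R x"] by (cases "r \<ge> 0") auto
  qed (rule add)
  with m(3) that show thesis by blast
qed

text \<open>The linear minorant of the increment \<open>k (x0 + v) - k x0\<close> comes from the
  algebraic Hahn--Banach theorem above; the upper bound on \<open>k\<close> near \<open>x0\<close>
  makes it continuous.\<close>

lemma convex_subgradient: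
  fixes k :: "'a::real_normed_vector \<Rightarrow> real"
  assumes k: "convex_on UNIV k" and d: "d > 0" and bd: "\<And>x. dist x x0 < d \<Longrightarrow> k x \<le> M"
  obtains x' :: "'a \<Rightarrow>\<^sub>L real" where "\<And>x. k x0 + blinfun_apply x' (x - x0) \<le> k x"
proof -
  have "convex_on UNIV (\<lambda>v. k (x0 + v) - k x0)"
  proof (rule convex_onI)
    fix t :: real and x y :: 'a
    assume "t > 0" "t < 1"
    then have "k ((1 - t) *\<^sub>R (x0 + x) + t *\<^sub>R (x0 + y)) \<le> (1 - t) * k (x0 + x) + t * k (x0 + y)"
      by (intro convex_onD[OF k]) auto
    then show "k (x0 + ((1 - t) *\<^sub>R x + t *\<^sub>R y)) - k x0
        \<le> (1 - t) * (k (x0 + x) - k x0) + t * (k (x0 + y) - k x0)"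
      by (simp add: algebra_simps)
  qed simp
  then obtain l where l: "linear l" "\<And>v. l v \<le> k (x0 + v) - k x0"
    by (rule convex_linear_minorant) auto
  define B where "B = M - k x0"
  have lB: "l v \<le> B" if "norm v < d" for v
    using l(2)[of v] bd[of "x0 + v"] that by (simp add: B_def dist_norm)
  \<comment> \<open>Rescaling \<open>v\<close> to norm \<open>d / 2\<close> carries the bound from
    the ball to all vectors; applied to \<open>- v\<close> as well, it bounds the absolute
    value.\<close>
  have bound: "l v \<le> norm v * (2 * B / d)" for v
  proof (cases "v = 0")
    case False
    have "l ((d / (2 * norm v)) *\<^sub>R v) \<le> B" using False d by (intro lB) auto
    then have "d / (2 * norm v) * l v \<le> B" using linear_scale[OF l(1)] by simp
    then show ?thesis using False d by (simp add: field_simps)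
  qed (simp add: linear_0[OF l(1)])
  have "bounded_linear l"
  proof (rule bounded_linear_intro)
    show "norm (l v) \<le> norm v * (2 * B / d)" for v
      using bound[of v] bound[of "- v"] linear_neg[OF l(1), of v] by simp
  qed (auto simp: linear_add[OF l(1)] linear_scale[OF l(1)])
  then have "k x0 + blinfun_apply (Blinfun l) (x - x0) \<le> k x" for x
    using l(2)[of "x - x0"] by (simp add: bounded_linear_Blinfun_apply)
  with that show thesis by blast
qed

subsection \<open>Infimal convolution and biconjugation\<close>

lemma lower_semicontinuous_ball:
  fixes f :: "'a::metric_space \<Rightarrow> ereal"
  assumes "lower_semicontinuous f" "r < f x"
  obtains d where "d > 0" "\<And>y. dist y x < d \<Longrightarrow> r < f y"
proof -
  have "r < Liminf (at x) f" using assms by (auto simp: lower_semicontinuous_def intro: less_le_trans)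
  then have "eventually (\<lambda>y. r < f y) (at x)" by (rule less_LiminfD)
  then obtain d where "d > 0" "\<And>y. y \<noteq> x \<Longrightarrow> dist y x < d \<Longrightarrow> r < f y"
    by (auto simp: eventually_at)
  \<comment> \<open>The filter \<open>at x\<close> leaves out \<open>x\<close> itself, where the
    second assumption gives the bound.\<close>
  with assms(2) that show thesis by metis
qed

text \<open>Lower semicontinuity bounds \<open>f\<close> below on a ball around a point
  \<open>x1\<close> of its domain. A very negative value at a distant \<open>y\<close> would, by
  convexity along the segment from \<open>x1\<close> to \<open>y\<close>, violate this bound inside
  the ball, so \<open>f\<close> decreases at most linearly.\<close>

lemma Gamma0_lower_bound:
  fixes f :: "'a::real_normed_vector \<Rightarrow> ereal"
  assumes "f \<in> Gamma0"
  obtains C where "C \<ge> 0" "\<And>y. ereal (- C - C * norm y) \<le> f y"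
proof -
  have f: "\<And>x. f x \<noteq> -\<infinity>" "ereal_convex f" "lower_semicontinuous f"
    using assms by (auto simp: Gamma0_def)
  obtain x1 where "f x1 \<noteq> \<infinity>" using assms by (auto simp: Gamma0_def)
  with f(1) obtain a where a: "f x1 = ereal a" by (metis ereal_cases)
  have "ereal (a - 1) < f x1" by (simp add: a)
  then obtain d where d: "d > 0" "\<And>y. dist y x1 < d \<Longrightarrow> ereal (a - 1) < f y"
    using lower_semicontinuous_ball[OF f(3)] by metis
  have low: "ereal (a - 1 - 2 * norm (y - x1) / d) \<le> f y" for y
  proof (cases "norm (y - x1) < d")
    case True
    then have "ereal (a - 1) < f y" using d(2)[of y] by (simp add: dist_norm)
    moreover have "2 * norm (y - x1) / d \<ge> 0" using d(1) by simp
    then have "ereal (a - 1 - 2 * norm (y - x1) / d) \<le> ereal (a - 1)" by simp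
    ultimately show ?thesis by (meson less_imp_le order_trans)
  next
    case False
    define s where "s = norm (y - x1)"
    \<comment> \<open>Places \<open>z\<close> on the segment from \<open>x1\<close> to
      \<open>y\<close> at distance \<open>d / 2\<close> from \<open>x1\<close>, inside the
      ball.\<close>
    define t where "t = d / (2 * s)"
    have s: "s \<ge> d" "s > 0" using False d(1) by (auto simp: s_def)
    then have t: "t > 0" "t < 1" using d(1) by (auto simp: t_def)
    define z where "z = (1 - t) *\<^sub>R x1 + t *\<^sub>R y"
    have "z - x1 = t *\<^sub>R (y - x1)" by (simp add: z_def algebra_simps)
    then have "norm (z - x1) = t * s" using t by (simp add: s_def)
    also have "\<dots> < d" using s d(1) by (simp add: t_def)
    finally have z: "ereal (a - 1) < f z" using d(2)[of z] by (simp add: dist_norm)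
    have "f z \<le> ereal (1 - t) * f x1 + ereal t * f y"
      using f(2) t unfolding z_def ereal_convex_def by auto
    with z have lt: "ereal (a - 1) < ereal (1 - t) * ereal a + ereal t * f y" by (simp add: a)
    show ?thesis
    proof (cases "f y")
      case (real b)
      with lt have "a - 1 < (1 - t) * a + t * b" by simp
      then have "t * (a - b) < 1" by (simp add: algebra_simps)
      then have "a - b < 1 / t" using t by (simp add: field_simps)
      also have "1 / t = 2 * s / d" by (simp add: t_def)
      finally show ?thesis by (simp add: real s_def)
    qed (use f(1) in auto)
  qed
  define C where "C = \<bar>a\<bar> + 1 + 2 * norm x1 / d + 2 / d"
  have "C \<ge> 0" using d(1) by (simp add: C_def)
  moreover have "ereal (- C - C * norm y) \<le> f y" for y
  proof -
    have "2 * norm (y - x1) / d \<le> 2 * (norm y + norm x1) / d"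
      using d(1) norm_triangle_ineq4[of y x1] by (intro divide_right_mono) auto
    also have "\<dots> = 2 / d * norm y + 2 * norm x1 / d" by (simp add: add_divide_distrib ring_distribs)
    finally have "2 * norm (y - x1) / d \<le> 2 / d * norm y + 2 * norm x1 / d" .
    moreover have "2 / d * norm y \<le> C * norm y"
      using d(1) by (intro mult_right_mono) (auto simp: C_def)
    moreover have "\<bar>a\<bar> + 1 + 2 * norm x1 / d \<le> C" using d(1) by (simp add: C_def)
    ultimately have "- C - C * norm y \<le> a - 1 - 2 * norm (y - x1) / d" by linarith
    then show ?thesis using low[of y] by (meson ereal_less_eq(3) order_trans)
  qed
  ultimately show thesis using that by blast
qed

text \<open>The infimal convolution, with a real-valued kernel \<open>h\<close>. Two kernels occur:
  the scaled power of the norm and the Lipschitz kernel \<open>n * norm z\<close>.\<close>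

definition inf_conv :: "('a::real_normed_vector \<Rightarrow> ereal) \<Rightarrow> ('a \<Rightarrow> real) \<Rightarrow> 'a \<Rightarrow> ereal" where
  "inf_conv g h x = (INF y. g y + ereal (h (x - y)))"

lemma inf_conv_le: "inf_conv g h x \<le> g y + ereal (h (x - y))"
  unfolding inf_conv_def by (rule INF_lower) simp

lemma moreau_yosida_eq_inf_conv:
  "moreau_yosida p \<epsilon> g = inf_conv g (\<lambda>z. 1 / (p * \<epsilon>) * norm z powr p)"
  by (simp add: fun_eq_iff moreau_yosida_def inf_conv_def)

text \<open>The growth of \<open>h\<close> compensates the at most linear decrease of
  \<open>g\<close>, so the infimum is finite; joint convexity of \<open>g y + h (x - y)\<close>
  makes it convex; and the single competitor \<open>y0\<close> bounds it above locally, which yields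
  subgradients at every point.\<close>

lemma inf_conv_real_convex:
  fixes g :: "'a::real_normed_vector \<Rightarrow> ereal" and h :: "'a \<Rightarrow> real"
  assumes C: "C \<ge> 0" "\<And>y. ereal (- C - C * norm y) \<le> g y"
    and g: "g y0 \<noteq> \<infinity>" "ereal_convex g"
    and h: "convex_on UNIV h" "continuous_on UNIV h" "\<And>z. C * norm z - D \<le> h z"
  obtains k where "\<And>x. inf_conv g h x = ereal (k x)"
    and "\<And>x0. \<exists>x'. \<forall>x. k x0 + blinfun_apply x' (x - x0) \<le> k x"
proof -
  \<comment> \<open>On the effective domain of \<open>g\<close> the infimum can be taken in the
    reals; all other \<open>y\<close> contribute infinity.\<close>
  define I where "I = {y. g y \<noteq> \<infinity>}"
  define \<gamma> where "\<gamma> = (\<lambda>y. real_of_ereal (g y))"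
  have \<gamma>: "g y = ereal (\<gamma> y)" if "y \<in> I" for y
    using that C(2)[of y] by (cases "g y") (auto simp: I_def \<gamma>_def)
  have ne: "I \<noteq> {}" "y0 \<in> I" using g(1) by (auto simp: I_def)
  define F where "F = (\<lambda>y x. \<gamma> y + h (x - y))"
  define k where "k = (\<lambda>x. INF y\<in>I. F y x)"
  have bdd: "bdd_below ((\<lambda>y. F y x) ` I)" for x
  proof (rule bdd_belowI2)
    fix y assume "y \<in> I"
    then have "- C - C * norm y \<le> \<gamma> y" using C(2)[of y] \<gamma>[of y] by simp
    moreover have "norm y \<le> norm x + norm (x - y)" using norm_triangle_sub[of y x] by (simp add: norm_minus_commute)
    then have "C * norm y \<le> C * norm x + C * norm (x - y)"
      using C(1) by (metis mult_left_mono distrib_left)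
    ultimately show "- C - C * norm x - D \<le> F y x" using h(3)[of "x - y"] by (simp add: F_def)
  qed
  have low: "k x \<le> F y x" if "y \<in> I" for x y
    unfolding k_def by (rule cINF_lower[OF bdd that])
  have "convex_on UNIV k"
    unfolding k_def
  proof (rule convex_on_INF[OF ne(1) bdd])
    fix i j x y and t :: real
    assume ij: "i \<in> I" "j \<in> I" and t: "0 < t" "t < 1"
    define m where "m = (1 - t) *\<^sub>R i + t *\<^sub>R j"
    have "g m \<le> ereal (1 - t) * g i + ereal t * g j"
      using g(2) t unfolding ereal_convex_def m_def by auto
    then have gm: "g m \<le> ereal ((1 - t) * \<gamma> i + t * \<gamma> j)" by (simp add: \<gamma> ij)
    then have m: "m \<in> I" by (auto simp: I_def)
    with gm have "\<gamma> m \<le> (1 - t) * \<gamma> i + t * \<gamma> j" by (simp add: \<gamma>)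
    moreover have "h ((1 - t) *\<^sub>R (x - i) + t *\<^sub>R (y - j)) \<le> (1 - t) * h (x - i) + t * h (y - j)"
      using t by (intro convex_onD[OF h(1)]) auto
    moreover have "(1 - t) *\<^sub>R (x - i) + t *\<^sub>R (y - j) = (1 - t) *\<^sub>R x + t *\<^sub>R y - m"
      by (simp add: m_def algebra_simps)
    ultimately have "F m ((1 - t) *\<^sub>R x + t *\<^sub>R y) \<le>
        ((1 - t) * \<gamma> i + t * \<gamma> j) + ((1 - t) * h (x - i) + t * h (y - j))"
      unfolding F_def by (metis add_mono)
    also have "\<dots> = (1 - t) * F i x + t * F j y"
      by (simp add: F_def algebra_simps)
    finally have "F m ((1 - t) *\<^sub>R x + t *\<^sub>R y) \<le> (1 - t) * F i x + t * F j y" .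
    with m show "\<exists>m\<in>I. F m ((1 - t) *\<^sub>R x + t *\<^sub>R y) \<le> (1 - t) * F i x + t * F j y" by blast
  qed
  have "\<exists>x'. \<forall>x. k x0 + blinfun_apply x' (x - x0) \<le> k x" for x0
  proof -
    obtain d where d: "d > 0" "\<And>z. dist z (x0 - y0) < d \<Longrightarrow> dist (h z) (h (x0 - y0)) < 1"
      using h(2) unfolding continuous_on_iff by (metis UNIV_I zero_less_one)
    have "k x \<le> \<gamma> y0 + h (x0 - y0) + 1" if "dist x x0 < d" for x
      using low[OF ne(2), of x] d(2)[of "x - y0"] that by (simp add: F_def dist_norm)
    then obtain x' where "\<And>x. k x0 + blinfun_apply x' (x - x0) \<le> k x"
      using convex_subgradient[OF \<open>convex_on UNIV k\<close> d(1)] by blast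
    then show ?thesis by blast
  qed
  moreover have "inf_conv g h x = ereal (k x)" for x
  proof (rule antisym)
    show "ereal (k x) \<le> inf_conv g h x"
      unfolding inf_conv_def
    proof (rule INF_greatest)
      fix y
      show "ereal (k x) \<le> g y + ereal (h (x - y))"
      proof (cases "y \<in> I")
        case True
        with low[OF True, of x] show ?thesis by (simp add: \<gamma> F_def)
      qed (simp add: I_def)
    qed
    show "inf_conv g h x \<le> ereal (k x)"
    proof (rule ereal_le_epsilon2)
      fix e :: real assume "e > 0"
      then obtain y where y: "y \<in> I" "F y x < k x + e"
        using cINF_less_iff[OF ne(1) bdd, of x "k x + e"] by (auto simp: k_def)
      have "inf_conv g h x \<le> ereal (F y x)" using inf_conv_le[of g h x y] by (simp add: \<gamma> y F_def)
      also have "\<dots> \<le> ereal (k x) + ereal e" using y by simp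
      finally show "inf_conv g h x \<le> ereal (k x) + ereal e" .
    qed
  qed
  ultimately show thesis using that by blast
qed

lemma Fenchel_Young:
  "ereal (blinfun_apply x' x) - f x \<le> convex_conjugate f x'"
  unfolding convex_conjugate_def by (rule SUP_upper) simp

text \<open>An affine minorant with slope \<open>x'\<close> and constant \<open>c\<close> forces the
  conjugate at \<open>x'\<close> to be at most \<open>- c\<close>, so \<open>x'\<close> contributes
  at least \<open>r\<close> to the supremum. The reverse inequality is Fenchel--Young.\<close>

lemma biconjugate_eqI:
  fixes f :: "'a::real_normed_vector \<Rightarrow> ereal"
  assumes "\<And>r. ereal r < f x \<Longrightarrow>
    \<exists>x' c. r \<le> blinfun_apply x' x + c \<and> (\<forall>y. ereal (blinfun_apply x' y + c) \<le> f y)"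
  shows "f x = (SUP x'. ereal (blinfun_apply x' x) - convex_conjugate f x')"
proof (rule antisym)
  show "f x \<le> (SUP x'. ereal (blinfun_apply x' x) - convex_conjugate f x')" (is "_ \<le> ?S")
  proof (rule dense_le)
    fix r assume r: "r < f x"
    show "r \<le> ?S"
    proof (cases r)
      case (real \<rho>)
      with r assms obtain x' c where xc: "\<rho> \<le> blinfun_apply x' x + c"
        "\<And>y. ereal (blinfun_apply x' y + c) \<le> f y" by blast
      have "convex_conjugate f x' \<le> ereal (- c)"
        unfolding convex_conjugate_def
      proof (rule SUP_least)
        fix y
        show "ereal (blinfun_apply x' y) - f y \<le> ereal (- c)"
          using xc(2)[of y] by (cases "f y") auto
      qed
      then have "ereal (blinfun_apply x' x) - ereal (- c) \<le> ereal (blinfun_apply x' x) - convex_conjugate f x'"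
        by (intro ereal_minus_mono) auto
      also have "\<dots> \<le> ?S" by (rule SUP_upper) simp
      finally have "ereal (blinfun_apply x' x + c) \<le> ?S" by simp
      with xc(1) show ?thesis unfolding real by (meson ereal_less_eq(3) order_trans)
    qed (use r in auto)
  qed
  show "?S \<le> f x"
  proof (rule SUP_least)
    fix x' :: "'a \<Rightarrow>\<^sub>L real"
    show "ereal (blinfun_apply x' x) - convex_conjugate f x' \<le> f x"
      using Fenchel_Young[of x' x f] by (cases "f x"; cases "convex_conjugate f x'") auto
  qed
qed

lemma convex_on_norm_scale:
  assumes "n \<ge> 0"
  shows "convex_on UNIV (\<lambda>z::'a::real_normed_vector. n * norm z)"
proof (rule convex_onI)
  fix t :: real and x y :: 'a
  assume "t > 0" "t < 1"
  then have "norm ((1 - t) *\<^sub>R x + t *\<^sub>R y) \<le> (1 - t) * norm x + t * norm y"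
    using norm_triangle_ineq[of "(1 - t) *\<^sub>R x" "t *\<^sub>R y"] by simp
  then have "n * norm ((1 - t) *\<^sub>R x + t *\<^sub>R y) \<le> n * ((1 - t) * norm x + t * norm y)"
    using assms by (rule mult_left_mono)
  then show "n * norm ((1 - t) *\<^sub>R x + t *\<^sub>R y) \<le> (1 - t) * (n * norm x) + t * (n * norm y)"
    by (simp add: algebra_simps)
qed simp

text \<open>
  For large \<open>n\<close> the Lipschitz regularization \<open>inf_conv f (\<lambda>z. n * norm z)\<close> exceeds \<open>r\<close> at \<open>x\<close>;
  a subgradient of it at \<open>x\<close> yields the minorant.
\<close>

lemma Gamma0_affine_minorant:
  fixes f :: "'a::real_normed_vector \<Rightarrow> ereal"
  assumes f: "f \<in> Gamma0" and r: "ereal r < f x"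
  obtains x' c where "r \<le> blinfun_apply x' x + c" "\<And>y. ereal (blinfun_apply x' y + c) \<le> f y"
proof -
  obtain C where C: "C \<ge> 0" "\<And>y. ereal (- C - C * norm y) \<le> f y"
    using Gamma0_lower_bound[OF f] by blast
  obtain d where d: "d > 0" "\<And>y. dist y x < d \<Longrightarrow> ereal r < f y"
    using lower_semicontinuous_ball[of f "ereal r" x] f r by (auto simp: Gamma0_def)
  \<comment> \<open>Chosen so that outside the ball of radius \<open>d\<close> the penalty
    \<open>n * norm (x - y)\<close> lifts the linear lower bound of \<open>f\<close> to at least
    \<open>r\<close>; inside the ball \<open>f\<close> exceeds \<open>r\<close> already.\<close>
  define n where "n = C + max 0 ((r + C + C * norm x) / d)"
  have n: "n \<ge> C" "r + C + C * norm x \<le> (n - C) * d"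
    using d(1) by (auto simp: n_def max_def field_simps)
  define h where "h = (\<lambda>z::'a. n * norm z)"
  obtain y0 where y0: "f y0 \<noteq> \<infinity>" using f by (auto simp: Gamma0_def)
  have h: "convex_on UNIV h" "continuous_on UNIV h" "C * norm z - 0 \<le> h z" for z
    using n C(1) by (auto simp: h_def intro!: convex_on_norm_scale continuous_intros mult_right_mono)
  obtain k where k: "\<And>x. inf_conv f h x = ereal (k x)"
      "\<And>x0. \<exists>x'. \<forall>x. k x0 + blinfun_apply x' (x - x0) \<le> k x"
    using inf_conv_real_convex[OF C y0 _ h] f by (auto simp: Gamma0_def)
  have "ereal r \<le> inf_conv f h x"
    unfolding inf_conv_def
  proof (rule INF_greatest)
    fix y
    show "ereal r \<le> f y + ereal (h (x - y))"
    proof (cases "dist y x < d")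
      case True
      then have "ereal r \<le> f y" using d(2) by (simp add: less_imp_le)
      moreover have "0 \<le> ereal (h (x - y))" using n C(1) by (simp add: h_def)
      ultimately show ?thesis by (metis add_mono add.right_neutral)
    next
      case False
      then have "(n - C) * d \<le> (n - C) * norm (x - y)"
        using n(1) by (intro mult_left_mono) (auto simp: dist_norm norm_minus_commute)
      moreover have "norm y \<le> norm x + norm (x - y)"
        using norm_triangle_sub[of y x] by (simp add: norm_minus_commute)
      then have "C * norm y \<le> C * norm x + C * norm (x - y)"
        using C(1) by (metis mult_left_mono distrib_left)
      ultimately have "r \<le> (- C - C * norm y) + h (x - y)"
        using n(2) by (simp add: h_def left_diff_distrib)
      then have "ereal r \<le> ereal (- C - C * norm y) + ereal (h (x - y))" by simp
      also have "\<dots> \<le> f y + ereal (h (x - y))" by (intro add_mono C) simp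
      finally show ?thesis .
    qed
  qed
  then have rk: "r \<le> k x" by (simp add: k)
  obtain x' where x': "\<And>y. k x + blinfun_apply x' (y - x) \<le> k y" using k(2) by blast
  have "ereal (blinfun_apply x' y + (k x - blinfun_apply x' x)) \<le> f y" for y
  proof -
    have "ereal (blinfun_apply x' y + (k x - blinfun_apply x' x)) \<le> ereal (k y)"
      using x'[of y] by (simp add: blinfun.diff_right)
    \<comment> \<open>The competitor \<open>y\<close> itself costs nothing, as
      \<open>h 0 = 0\<close>.\<close>
    also have "\<dots> \<le> f y" using inf_conv_le[of f h y y] by (simp add: k) (simp add: h_def)
    finally show ?thesis .
  qed
  with that[of x' "k x - blinfun_apply x' x"] rk show thesis by simp
qed

lemma Fenchel_Moreau:
  fixes f :: "'a::real_normed_vector \<Rightarrow> ereal"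
  assumes "f \<in> Gamma0"
  shows "f x = (SUP x'. ereal (blinfun_apply x' x) - convex_conjugate f x')"
proof (rule biconjugate_eqI)
  fix r assume "ereal r < f x"
  then obtain x' c where "r \<le> blinfun_apply x' x + c" "\<And>y. ereal (blinfun_apply x' y + c) \<le> f y"
    using Gamma0_affine_minorant[OF assms] by blast
  then show "\<exists>x' c. r \<le> blinfun_apply x' x + c \<and> (\<forall>y. ereal (blinfun_apply x' y + c) \<le> f y)"
    by blast
qed

text \<open>Both sides are the supremum over \<open>y\<close> and \<open>z\<close> of
  \<open>x' (y + z) - g y - h z\<close>, where \<open>z = x - y\<close>; it splits into a sum of two
  suprema because \<open>y\<close> and \<open>z\<close> vary independently.\<close>

lemma conjugate_inf_conv:
  fixes g :: "'a::real_normed_vector \<Rightarrow> ereal"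
  assumes g: "\<And>y. g y \<noteq> -\<infinity>"
    and H: "convex_conjugate (\<lambda>z. ereal (h z)) x' = ereal H"
  shows "convex_conjugate (inf_conv g h) x' = convex_conjugate g x' + ereal H"
proof (rule antisym)
  show "convex_conjugate (inf_conv g h) x' \<le> convex_conjugate g x' + ereal H"
    unfolding convex_conjugate_def[of "inf_conv g h"]
  proof (rule SUP_least)
    fix x
    have "ereal (blinfun_apply x' x) - inf_conv g h x =
        (SUP y. ereal (blinfun_apply x' x) - (g y + ereal (h (x - y))))"
      unfolding inf_conv_def by (rule SUP_ereal_minus_right[symmetric]) auto
    also have "\<dots> \<le> convex_conjugate g x' + ereal H"
    proof (rule SUP_least)
      fix y
      show "ereal (blinfun_apply x' x) - (g y + ereal (h (x - y))) \<le> convex_conjugate g x' + ereal H"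
      proof (cases "g y")
        case (real \<gamma>)
        have "ereal (blinfun_apply x' y) - g y + (ereal (blinfun_apply x' (x - y)) - ereal (h (x - y)))
            \<le> convex_conjugate g x' + ereal H"
          unfolding H[symmetric] by (intro add_mono Fenchel_Young)
        then show ?thesis by (simp add: real blinfun.diff_right algebra_simps)
      qed (use g in auto)
    qed
    finally show "ereal (blinfun_apply x' x) - inf_conv g h x \<le> convex_conjugate g x' + ereal H" .
  qed
  have "convex_conjugate g x' + ereal H = (SUP y. ereal (blinfun_apply x' y) - g y + ereal H)"
    unfolding convex_conjugate_def by (rule SUP_ereal_add_left[symmetric]) auto
  also have "\<dots> \<le> convex_conjugate (inf_conv g h) x'"
  proof (rule SUP_least)
    fix y
    show "ereal (blinfun_apply x' y) - g y + ereal H \<le> convex_conjugate (inf_conv g h) x'"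
    proof (cases "g y")
      case (real \<gamma>)
      have "ereal (blinfun_apply x' y - \<gamma>) + ereal H =
          (SUP z. ereal (blinfun_apply x' y - \<gamma>) + (ereal (blinfun_apply x' z) - ereal (h z)))"
        unfolding H[symmetric] convex_conjugate_def by (rule SUP_ereal_add_right[symmetric]) auto
      also have "\<dots> \<le> convex_conjugate (inf_conv g h) x'"
      proof (rule SUP_least)
        fix z
        have "ereal (blinfun_apply x' (y + z)) - (g y + ereal (h z)) \<le>
            ereal (blinfun_apply x' (y + z)) - inf_conv g h (y + z)"
          using inf_conv_le[of g h "y + z" y] by (intro ereal_minus_mono) auto
        also have "\<dots> \<le> convex_conjugate (inf_conv g h) x'" by (rule Fenchel_Young)
        finally show "ereal (blinfun_apply x' y - \<gamma>) + (ereal (blinfun_apply x' z) - ereal (h z))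
            \<le> convex_conjugate (inf_conv g h) x'"
          by (simp add: real blinfun.add_right algebra_simps)
      qed
      finally show ?thesis by (simp add: real)
    qed (use g in auto)
  qed
  finally show "convex_conjugate g x' + ereal H \<le> convex_conjugate (inf_conv g h) x'" .
qed

subsection \<open>Powers of the norm\<close>

text \<open>The operator norm need not be attained, hence the slack \<theta>. If no vector beat
  \<theta>, the norm would be at most \<theta>; a vector that does is given the right sign and then
  rescaled to norm \<open>T\<close>.\<close>

lemma blinfun_norming_vector:
  fixes x' :: "'a::real_normed_vector \<Rightarrow>\<^sub>L real"
  assumes "0 \<le> \<theta>" "\<theta> < norm x'" "T \<ge> 0"
  obtains v where "norm v = T" "\<theta> * T \<le> blinfun_apply x' v"
proof -
  obtain w where w: "\<theta> * norm w < \<bar>blinfun_apply x' w\<bar>"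
    using norm_blinfun_bound[OF assms(1), of x'] assms(2) by (auto simp: not_le[symmetric])
  define u where "u = sgn (blinfun_apply x' w) *\<^sub>R w"
  have "0 \<le> \<theta> * norm w" using assms(1) by simp
  then have u: "\<theta> * norm u < blinfun_apply x' u"
    using w by (auto simp: u_def blinfun.scaleR_right abs_real_def sgn_real_def split: if_splits)
  then have "norm u > 0" by (metis blinfun.zero_right mult_zero_right norm_zero zero_less_norm_iff less_irrefl)
  show thesis
  proof (rule that)
    show "norm ((T / norm u) *\<^sub>R u) = T" using \<open>norm u > 0\<close> assms(3) by simp
    have "T / norm u * (\<theta> * norm u) \<le> T / norm u * blinfun_apply x' u"
      using u \<open>norm u > 0\<close> assms(3) by (intro mult_left_mono) auto
    then show "\<theta> * T \<le> blinfun_apply x' ((T / norm u) *\<^sub>R u)"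
      using \<open>norm u > 0\<close> by (simp add: blinfun.scaleR_right mult.commute)
  qed
qed

lemma conjugate_exponent_gt_1:
  fixes p q :: real
  assumes "1 < p" "1 / p + 1 / q = 1"
  shows "q > 1"
proof -
  have "1 / q = 1 - 1 / p" using assms by simp
  moreover have "0 < 1 - 1 / p" "1 - 1 / p < 1" using assms(1) by auto
  ultimately have "0 < 1 / q" "1 / q < 1" by auto
  then show ?thesis by (cases "q > 0") (auto simp: field_simps)
qed

text \<open>Young's inequality for \<open>t\<close> and \<open>\<epsilon> * s\<close>, divided by
  \<epsilon>.\<close>

lemma Young_scaled:
  fixes p q \<epsilon> s t :: real
  assumes "1 < p" "1 / p + 1 / q = 1" "\<epsilon> > 0" "s \<ge> 0" "t \<ge> 0"
  shows "s * t \<le> \<epsilon> powr (q - 1) * (s powr q / q) + 1 / (p * \<epsilon>) * t powr p"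
proof -
  note q = conjugate_exponent_gt_1[OF assms(1,2)]
  have "t * (\<epsilon> * s) \<le> t powr p / p + (\<epsilon> * s) powr q / q"
    using assms q by (intro Youngs_inequality) auto
  then have "t * (\<epsilon> * s) / \<epsilon> \<le> (t powr p / p + (\<epsilon> * s) powr q / q) / \<epsilon>"
    using assms(3) by (intro divide_right_mono) auto
  also have "(\<epsilon> * s) powr q = \<epsilon> * \<epsilon> powr (q - 1) * s powr q"
    using assms by (simp add: powr_mult powr_diff)
  finally show ?thesis using assms(1,3) q by (simp add: field_simps)
qed

text \<open>The upper bound is Young's inequality. The lower bound tests vectors whose length gives
  equality there and whose direction almost norms \<open>x'\<close>.\<close>

lemma conjugate_power_norm:
  fixes x' :: "'a::real_normed_vector \<Rightarrow>\<^sub>L real"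
  assumes p: "1 < p" "1 / p + 1 / q = 1" and \<epsilon>: "\<epsilon> > 0"
  shows "convex_conjugate (\<lambda>z. ereal (1 / (p * \<epsilon>) * norm z powr p)) x' =
    ereal (\<epsilon> powr (q - 1) * phi q x')" (is "?L = ereal ?B")
proof (rule antisym)
  show "?L \<le> ereal ?B"
    unfolding convex_conjugate_def
  proof (rule SUP_least)
    fix z
    have "blinfun_apply x' z \<le> norm x' * norm z" using norm_blinfun[of x' z] by simp
    also have "\<dots> \<le> ?B + 1 / (p * \<epsilon>) * norm z powr p"
      using Young_scaled[OF p \<epsilon>, of "norm x'" "norm z"] by (simp add: phi_def)
    finally show "ereal (blinfun_apply x' z) - ereal (1 / (p * \<epsilon>) * norm z powr p) \<le> ereal ?B" by simp
  qed
  note q = conjugate_exponent_gt_1[OF p]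
  define s where "s = norm x'"
  show "ereal ?B \<le> ?L"
  proof (cases "s = 0")
    case True
    then have "?B = 0" using q by (simp add: phi_def s_def)
    moreover have "0 \<le> ?L"
      using Fenchel_Young[of x' 0 "\<lambda>z. ereal (1 / (p * \<epsilon>) * norm z powr p)"] p by simp
    ultimately show ?thesis by (metis zero_ereal_def)
  next
    case False
    then have s: "s > 0" by (simp add: s_def)
    \<comment> \<open>The maximizer of \<open>s * t - t powr p / (p * \<epsilon>)\<close> over
      \<open>t > 0\<close>, since \<open>1 / (p - 1) = q - 1\<close>.\<close>
    define T where "T = (\<epsilon> * s) powr (q - 1)"
    have T: "T > 0" using s \<epsilon> by (simp add: T_def)
    have "(q - 1) * p = q" using p q by (simp add: field_simps)
    then have Tp: "T powr p = (\<epsilon> * s) powr q" by (simp add: T_def powr_powr)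
    have eq: "(\<epsilon> * s) powr q = \<epsilon> * \<epsilon> powr (q - 1) * s powr q"
      using s \<epsilon> by (simp add: powr_mult powr_diff)
    have sT: "s * T = \<epsilon> powr (q - 1) * s powr q"
      using s \<epsilon> by (simp add: T_def powr_mult powr_diff)
    have p': "1 / p = 1 - 1 / q" using p(2) by simp
    have "1 / (p * \<epsilon>) * T powr p = (1 / p) * (\<epsilon> powr (q - 1) * s powr q)"
      using \<epsilon> by (simp add: Tp eq)
    also have "\<dots> = s * T - ?B" unfolding p' sT by (simp add: phi_def s_def algebra_simps)
    finally have B: "?B = s * T - 1 / (p * \<epsilon>) * T powr p" by simp
    show ?thesis
    proof (rule ereal_le_epsilon2)
      fix e :: real assume e: "e > 0"
      \<comment> \<open>Over length \<open>T\<close> this slack loses at most \<open>e\<close>; the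
        maximum with \<open>0\<close> keeps \<theta> nonnegative.\<close>
      define \<theta> where "\<theta> = max 0 (s - e / T)"
      have \<theta>: "0 \<le> \<theta>" "\<theta> < norm x'" using s e T by (auto simp: \<theta>_def s_def)
      obtain v where v: "norm v = T" "\<theta> * T \<le> blinfun_apply x' v"
        using blinfun_norming_vector[OF \<theta>, of T] T by auto
      have "(s - e / T) * T \<le> \<theta> * T" using T by (intro mult_right_mono) (auto simp: \<theta>_def)
      moreover have "(s - e / T) * T = s * T - e" using T by (simp add: left_diff_distrib)
      ultimately have "s * T - e \<le> blinfun_apply x' v" using v by linarith
      then have "?B \<le> blinfun_apply x' v - 1 / (p * \<epsilon>) * norm v powr p + e" using B v(1) by simp
      then have "ereal ?B \<le> ereal (blinfun_apply x' v) - ereal (1 / (p * \<epsilon>) * norm v powr p) + ereal e" by simp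
      also have "\<dots> \<le> ?L + ereal e"
        by (intro add_mono Fenchel_Young[of _ _ "\<lambda>z. ereal (1 / (p * \<epsilon>) * norm z powr p)"]) simp
      finally show "ereal ?B \<le> ?L + ereal e" .
    qed
  qed
qed

lemma convex_on_power_norm:
  assumes p: "1 \<le> p" and c: "c \<ge> 0"
  shows "convex_on UNIV (\<lambda>z::'a::real_normed_vector. c * norm z powr p)"
proof (rule convex_onI)
  fix t :: real and x y :: 'a
  assume t: "t > 0" "t < 1"
  \<comment> \<open>Handles the case that \<open>x\<close> or \<open>y\<close> vanishes, where only
    one term remains.\<close>
  have scale: "(s * a) powr p \<le> s * a powr p" if "0 < s" "s < 1" "a \<ge> 0" for s a :: real
  proof -
    have "s powr p \<le> s powr 1" using that p by (intro powr_mono') auto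
    then show ?thesis using that by (simp add: powr_mult mult_right_mono)
  qed
  have "norm ((1 - t) *\<^sub>R x + t *\<^sub>R y) \<le> (1 - t) * norm x + t * norm y"
    using norm_triangle_ineq[of "(1 - t) *\<^sub>R x" "t *\<^sub>R y"] t by simp
  then have "norm ((1 - t) *\<^sub>R x + t *\<^sub>R y) powr p \<le> ((1 - t) * norm x + t * norm y) powr p"
    using p by (intro powr_mono2) auto
  also have "\<dots> \<le> (1 - t) * norm x powr p + t * norm y powr p"
  proof (cases "x = 0 \<or> y = 0")
    case True
    then show ?thesis using scale[of t "norm y"] scale[of "1 - t" "norm x"] t p by auto
  next
    case False
    then show ?thesis using convex_onD[OF powr_convex[OF p], of t "norm x" "norm y"] t by simp
  qed
  finally have "c * norm ((1 - t) *\<^sub>R x + t *\<^sub>R y) powr p \<le> c * ((1 - t) * norm x powr p + t * norm y powr p)"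
    using c by (rule mult_left_mono)
  then show "c * norm ((1 - t) *\<^sub>R x + t *\<^sub>R y) powr p \<le> (1 - t) * (c * norm x powr p) + t * (c * norm y powr p)"
    by (simp add: algebra_simps)
qed simp

section \<open>Finiteness and subgradients of the regularization, and the equivalence of (i) and
  (ii)\<close>

lemma moreau_yosida_real_convex:
  fixes g :: "'a::real_normed_vector \<Rightarrow> ereal"
  assumes p: "1 < p" "1 / p + 1 / q = 1" and \<epsilon>: "\<epsilon> > 0" and g: "g \<in> Gamma0"
  obtains k where "\<And>x. moreau_yosida p \<epsilon> g x = ereal (k x)"
    and "\<And>x0. \<exists>x'. \<forall>x. k x0 + blinfun_apply x' (x - x0) \<le> k x"
proof -
  obtain C where C: "C \<ge> 0" "\<And>y. ereal (- C - C * norm y) \<le> g y"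
    using Gamma0_lower_bound[OF g] by blast
  obtain y0 where y0: "g y0 \<noteq> \<infinity>" using g by (auto simp: Gamma0_def)
  define h where "h = (\<lambda>z::'a. 1 / (p * \<epsilon>) * norm z powr p)"
  have "convex_on UNIV h" unfolding h_def using p \<epsilon> by (intro convex_on_power_norm) auto
  moreover have "continuous_on UNIV h"
    unfolding h_def using p by (intro continuous_intros continuous_on_powr') auto
  \<comment> \<open>Young's inequality with \<open>s = C\<close>: the power outgrows the linear
    function up to a constant.\<close>
  moreover have "C * norm z - \<epsilon> powr (q - 1) * (C powr q / q) \<le> h z" for z
    using Young_scaled[OF p \<epsilon> C(1), of "norm z"] by (simp add: h_def)
  moreover have "ereal_convex g" using g by (simp add: Gamma0_def)
  ultimately obtain k where "\<And>x. inf_conv g h x = ereal (k x)"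
      "\<And>x0. \<exists>x'. \<forall>x. k x0 + blinfun_apply x' (x - x0) \<le> k x"
    using inf_conv_real_convex[OF C y0] by metis
  then show thesis
    unfolding h_def moreau_yosida_eq_inf_conv[symmetric] by (rule that)
qed

text \<open>A subgradient at \<open>x\<close> is an affine minorant exact at \<open>x\<close>. This
  is how the regularization, a finite function with subgradients everywhere, is recovered from its
  conjugate.\<close>

lemma biconjugate_real_convex:
  fixes k :: "'a::real_normed_vector \<Rightarrow> real"
  assumes "\<exists>x'. \<forall>y. k x + blinfun_apply x' (y - x) \<le> k y"
  shows "ereal (k x) = (SUP x'. ereal (blinfun_apply x' x) - convex_conjugate (\<lambda>x. ereal (k x)) x')"
proof (rule biconjugate_eqI)
  fix r assume r: "ereal r < ereal (k x)"
  from assms obtain x' where x': "\<And>y. k x + blinfun_apply x' (y - x) \<le> k y" by blast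
  show "\<exists>x' c. r \<le> blinfun_apply x' x + c \<and> (\<forall>y. ereal (blinfun_apply x' y + c) \<le> ereal (k y))"
    using r x' by (intro exI[of _ x'] exI[of _ "k x - blinfun_apply x' x"])
      (auto simp: blinfun.diff_right algebra_simps)
qed

lemma moreau_yosida_iff_conjugate:
  fixes f g :: "'a::real_normed_vector \<Rightarrow> ereal"
  assumes p: "1 < p" "1 / p + 1 / q = 1" and \<epsilon>: "\<epsilon> > 0" and f: "f \<in> Gamma0" and g: "g \<in> Gamma0"
  shows "(\<forall>x. f x = moreau_yosida p \<epsilon> g x) \<longleftrightarrow>
    (\<forall>x'. convex_conjugate f x' = convex_conjugate g x' + ereal (\<epsilon> powr (q - 1) * phi q x'))"
proof -
  have conj: "convex_conjugate (moreau_yosida p \<epsilon> g) x' =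
      convex_conjugate g x' + ereal (\<epsilon> powr (q - 1) * phi q x')" for x'
    unfolding moreau_yosida_eq_inf_conv
    using g by (intro conjugate_inf_conv conjugate_power_norm p \<epsilon>) (auto simp: Gamma0_def)
  obtain k where k: "\<And>x. moreau_yosida p \<epsilon> g x = ereal (k x)"
    and sub: "\<And>x0. \<exists>x'. \<forall>x. k x0 + blinfun_apply x' (x - x0) \<le> k x"
    using moreau_yosida_real_convex[OF p \<epsilon> g] by blast
  have keq: "moreau_yosida p \<epsilon> g = (\<lambda>x. ereal (k x))" using k by (simp add: fun_eq_iff)
  show ?thesis
  proof
    assume "\<forall>x. f x = moreau_yosida p \<epsilon> g x"
    then have "f = moreau_yosida p \<epsilon> g" by (simp add: fun_eq_iff)
    then show "\<forall>x'. convex_conjugate f x' = convex_conjugate g x' + ereal (\<epsilon> powr (q - 1) * phi q x')"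
      by (simp add: conj)
  next
    assume "\<forall>x'. convex_conjugate f x' = convex_conjugate g x' + ereal (\<epsilon> powr (q - 1) * phi q x')"
    then have "convex_conjugate f = convex_conjugate (moreau_yosida p \<epsilon> g)"
      by (simp add: conj fun_eq_iff)
    then show "\<forall>x. f x = moreau_yosida p \<epsilon> g x"
      unfolding keq by (metis Fenchel_Moreau[OF f] biconjugate_real_convex[OF sub])
  qed
qed

subsection \<open>Strong monotonicity\<close>

text \<open>Expansion of the power at \<open>1\<close> with a quadratic error. It lets the modulus
  of smoothness, which controls sums of norms, control sums of their powers.\<close>

lemma powr_le_affine_plus_square:
  fixes a p :: real
  assumes "1 < p" "p \<le> 2" "a \<ge> 0"
  shows "a powr p \<le> 1 + p * (a - 1) + (a - 1)\<^sup>2"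
proof (cases "a = 0")
  case False
  then have a: "a > 0" using assms(3) by simp
  \<comment> \<open>Weighted arithmetic-geometric mean for \<open>a\<close> and its square, with
    weights \<open>2 - p\<close> and \<open>p - 1\<close>.\<close>
  have "a powr p = a powr (2 - p) * (a\<^sup>2) powr (p - 1)"
    using a by (simp add: powr_powr powr_add[symmetric] flip: powr_numeral)
  also have "\<dots> \<le> (2 - p) * a + (p - 1) * a\<^sup>2"
    using assms a by (intro Youngs_inequality_0) auto
  also have "\<dots> \<le> (2 - p) * a + (p - 1) * a\<^sup>2 + (2 - p) * (a - 1)\<^sup>2"
    using assms(2) by simp
  also have "\<dots> = 1 + p * (a - 1) + (a - 1)\<^sup>2" by (simp add: power2_eq_square algebra_simps)
  finally show ?thesis .
qed (use assms in auto)

text \<open>For unit \<open>x\<close> and small \<open>y\<close> the powers are expanded at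
  \<open>1\<close>: the modulus bounds the linear part, and the squares are at most
  \<open>norm y powr p\<close> because \<open>p \<le> 2\<close>. For large \<open>y\<close> the
  triangle inequality suffices. Homogeneity then gives all nonzero \<open>u\<close>.\<close>

lemma p_smooth_power_norm:
  assumes "p_smooth_space TYPE('a::real_normed_vector) p" and p: "1 < p" "p \<le> 2"
  obtains K where "K > 0"
    "\<And>u v :: 'a. norm (u + v) powr p + norm (u - v) powr p \<le> 2 * norm u powr p + K * norm v powr p"
proof -
  obtain C where C: "C > 0"
    and mod: "\<And>\<tau>. \<tau> \<ge> 0 \<Longrightarrow> modulus_of_smoothness TYPE('a) \<tau> \<le> ereal (C * \<tau> powr p)"
    using assms(1) by (auto simp: p_smooth_space_def)
  have smooth: "norm (x + y) + norm (x - y) - 2 \<le> 2 * (C * norm y powr p)" if x: "norm x = 1" for x y :: 'a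
  proof -
    have "ereal (1/2 * (norm (x + y) + norm (x - y)) - 1) \<le> modulus_of_smoothness TYPE('a) (norm y)"
      unfolding modulus_of_smoothness_def using x by (intro Sup_upper) blast
    also have "\<dots> \<le> ereal (C * norm y powr p)" by (rule mod) simp
    finally show ?thesis by (simp add: field_simps)
  qed
  \<comment> \<open>The three terms pay for the linear part, the two squares, and the crude bound
    for \<open>norm y > 1\<close>.\<close>
  define K where "K = 2 * p * C + 2 + 2 * 2 powr p"
  have pos: "2 * p * C \<ge> 0" "2 powr p > 0" using p C by auto
  then have "K > 0" unfolding K_def by linarith
  have unit: "norm (x + y) powr p + norm (x - y) powr p \<le> 2 + K * norm y powr p"
    if x: "norm x = 1" for x y :: 'a
  proof (cases "norm y \<le> 1")
    case True
    have sq: "(norm z - 1)\<^sup>2 \<le> norm y powr p" if "\<bar>norm z - 1\<bar> \<le> norm y" for z :: 'a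
    proof -
      have "(norm z - 1)\<^sup>2 \<le> (norm y)\<^sup>2" using that by (metis abs_le_square_iff abs_norm_cancel)
      also have "\<dots> \<le> norm y powr p"
      proof (cases "y = 0")
        case False
        then have "norm y powr 2 \<le> norm y powr p" using p True by (intro powr_mono') auto
        with False show ?thesis by simp
      qed simp
      finally show ?thesis .
    qed
    have "\<bar>norm (x + y) - 1\<bar> \<le> norm y" "\<bar>norm (x - y) - 1\<bar> \<le> norm y"
      using norm_triangle_ineq3[of "x + y" x] norm_triangle_ineq3[of "x - y" x] x by auto
    then have "(norm (x + y) - 1)\<^sup>2 + (norm (x - y) - 1)\<^sup>2 \<le> 2 * norm y powr p"
      using sq[of "x + y"] sq[of "x - y"] by linarith
    moreover have "p * (norm (x + y) + norm (x - y) - 2) \<le> p * (2 * (C * norm y powr p))"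
      using p smooth[OF x] by (intro mult_left_mono) auto
    moreover have "2 * 2 powr p * norm y powr p \<ge> 0" by simp
    moreover have "norm (x + y) powr p + norm (x - y) powr p \<le>
        2 + p * (norm (x + y) + norm (x - y) - 2) + ((norm (x + y) - 1)\<^sup>2 + (norm (x - y) - 1)\<^sup>2)"
      using powr_le_affine_plus_square[OF p, of "norm (x + y)"]
        powr_le_affine_plus_square[OF p, of "norm (x - y)"] by (simp add: right_diff_distrib distrib_left)
    moreover have "2 + K * norm y powr p =
        2 + p * (2 * (C * norm y powr p)) + 2 * norm y powr p + 2 * 2 powr p * norm y powr p"
      by (simp add: K_def algebra_simps)
    ultimately show ?thesis by linarith
  next
    case False
    have le: "norm z powr p \<le> 2 powr p * norm y powr p" if "norm z \<le> norm x + norm y" for z :: 'a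
    proof -
      have "norm z powr p \<le> (2 * norm y) powr p" using that x False p by (intro powr_mono2) auto
      then show ?thesis by (simp add: powr_mult)
    qed
    have "norm (x + y) powr p + norm (x - y) powr p \<le> 2 * (2 powr p * norm y powr p)"
      using le[OF norm_triangle_ineq] le[OF norm_triangle_ineq4] by simp
    also have "\<dots> \<le> K * norm y powr p"
    proof -
      have "2 * 2 powr p \<le> K" using pos unfolding K_def by linarith
      then have "2 * 2 powr p * norm y powr p \<le> K * norm y powr p" by (rule mult_right_mono) simp
      then show ?thesis by simp
    qed
    finally show ?thesis by simp
  qed
  have "norm (u + v) powr p + norm (u - v) powr p \<le> 2 * norm u powr p + K * norm v powr p" for u v :: 'a
  proof (cases "u = 0")
    case True
    have "2 \<le> K" using pos unfolding K_def by linarith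
    then have "2 * norm v powr p \<le> K * norm v powr p" by (rule mult_right_mono) simp
    then show ?thesis using True p by simp
  next
    case False
    define s where "s = norm u"
    have s: "s > 0" using False by (simp add: s_def)
    have scale: "norm ((1 / s) *\<^sub>R z) powr p = norm z powr p / s powr p" for z :: 'a
      using s by (simp add: powr_divide)
    have "norm ((1 / s) *\<^sub>R u + (1 / s) *\<^sub>R v) powr p + norm ((1 / s) *\<^sub>R u - (1 / s) *\<^sub>R v) powr p
        \<le> 2 + K * norm ((1 / s) *\<^sub>R v) powr p"
      using s by (intro unit) (auto simp: s_def)
    then have "norm (u + v) powr p / s powr p + norm (u - v) powr p / s powr p
        \<le> 2 + K * (norm v powr p / s powr p)"
      unfolding scaleR_add_right[symmetric] scaleR_diff_right[symmetric] scale .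
    then have "(norm (u + v) powr p / s powr p + norm (u - v) powr p / s powr p) * s powr p
        \<le> (2 + K * (norm v powr p / s powr p)) * s powr p"
      by (rule mult_right_mono) simp
    then show ?thesis using s by (simp add: distrib_right s_def)
  qed
  with \<open>K > 0\<close> that show thesis by blast
qed

text \<open>One near-minimizer \<open>y\<close> for \<open>x\<close> competes at both
  \<open>x + v\<close> and \<open>x - v\<close>, so \<open>g\<close> enters on both sides with the
  same value. As \<open>v\<close> is fixed, \<open>M\<close> may depend on it.\<close>

lemma inf_conv_midpoint:
  fixes g :: "'a::real_normed_vector \<Rightarrow> ereal"
  assumes g: "\<And>y. g y \<noteq> -\<infinity>"
    and k: "\<And>x. inf_conv g h x = ereal (k x)"
    and h: "\<And>u. h (u + v) + h (u - v) \<le> 2 * h u + M"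
  shows "k (x + v) + k (x - v) \<le> 2 * k x + M"
proof (rule field_le_epsilon)
  fix e :: real assume "e > 0"
  then have "inf_conv g h x < ereal (k x + e / 2)" by (simp add: k)
  then obtain y where y: "g y + ereal (h (x - y)) < ereal (k x + e / 2)"
    unfolding inf_conv_def INF_less_iff by blast
  then obtain \<gamma> where \<gamma>: "g y = ereal \<gamma>" using g[of y] by (cases "g y") auto
  have low: "k z \<le> \<gamma> + h (z - y)" for z using inf_conv_le[of g h z y] by (simp add: k \<gamma>)
  have "x + v - y = (x - y) + v" "x - v - y = (x - y) - v" by simp_all
  with low[of "x + v"] low[of "x - v"]
  have "k (x + v) \<le> \<gamma> + h ((x - y) + v)" "k (x - v) \<le> \<gamma> + h ((x - y) - v)" by metis+
  then have "k (x + v) + k (x - v) \<le> 2 * \<gamma> + (h ((x - y) + v) + h ((x - y) - v))"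
    by simp
  also have "\<dots> \<le> 2 * \<gamma> + (2 * h (x - y) + M)" using h[of "x - y"] by simp
  also have "\<dots> \<le> 2 * k x + M + e" using y by (simp add: \<gamma>)
  finally show "k (x + v) + k (x - v) \<le> 2 * k x + M + e" .
qed

text \<open>
  If \<open>x \<in> \<partial>f\<^sup>*(x')\<close> then \<open>x'\<close> is a subgradient of \<open>f\<close> at \<open>x\<close>, so the hypothesis on \<open>k\<close> gives
  \<open>f (x + v) \<le> f x + x' v + K \<parallel>v\<parallel>\<^sup>p\<close> for all \<open>v\<close>; conjugating this bound yields strong convexity of \<open>f\<^sup>*\<close>.
\<close>

lemma strongly_monotone_conjugate:
  fixes k :: "'a::real_normed_vector \<Rightarrow> real"
  assumes p: "1 < p" "1 / p + 1 / q = 1" and K: "K > 0"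
    and biconj: "\<And>x. ereal (k x) = (SUP x'. ereal (blinfun_apply x' x) - convex_conjugate (\<lambda>x. ereal (k x)) x')"
    and mid: "\<And>x v. k (x + v) + k (x - v) \<le> 2 * k x + K * norm v powr p"
  shows "strongly_monotone q (dual_subdifferential (convex_conjugate (\<lambda>x. ereal (k x))))"
proof -
  define F where "F = convex_conjugate (\<lambda>x. ereal (k x))"
  \<comment> \<open>Makes \<open>K * norm v powr p\<close> the kernel with parameter \<delta>, whose
    conjugate is known.\<close>
  define \<delta> where "\<delta> = 1 / (p * K)"
  have \<delta>: "\<delta> > 0" using p K by (simp add: \<delta>_def)
  define c where "c = \<delta> powr (q - 1) / q"
  have "c > 0" using \<delta> conjugate_exponent_gt_1[OF p] by (simp add: c_def)
  have FY: "ereal (blinfun_apply x' x - k x) \<le> F x'" for x' x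
    using Fenchel_Young[of x' x "\<lambda>x. ereal (k x)"] by (simp add: F_def)
  \<comment> \<open>At an infinite value the choice \<open>y' = x'\<close> would require
    \<open>\<infinity> - \<infinity> = \<infinity>\<close> to be at most a real number; minus
    infinity is excluded by Fenchel--Young.\<close>
  have fin: "\<exists>a. F x' = ereal a" if "x \<in> dual_subdifferential F x'" for x x'
  proof (cases "F x'")
    case PInf
    have "F x' - F x' \<le> ereal (blinfun_apply (x' - x') x)"
      using that unfolding dual_subdifferential_def by blast
    with PInf show ?thesis by simp
  qed (use FY[of x' 0] in auto)
  have strong: "c * norm (y' - x') powr q \<le> b - a - blinfun_apply (y' - x') x"
    if x: "x \<in> dual_subdifferential F x'" and a: "F x' = ereal a" and b: "F y' = ereal b"
    for x x' y' a b
  proof -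
    \<comment> \<open>The subgradient inequality bounds every term of the biconjugate at
      \<open>x\<close>, which gives equality in Fenchel--Young for \<open>x\<close> and
      \<open>x'\<close>.\<close>
    have "ereal (k x) \<le> ereal (blinfun_apply x' x - a)"
      unfolding biconj[of x] F_def[symmetric]
    proof (rule SUP_least)
      fix z'
      have "F x' - F z' \<le> ereal (blinfun_apply (x' - z') x)"
        using x unfolding dual_subdifferential_def by blast
      then show "ereal (blinfun_apply z' x) - F z' \<le> ereal (blinfun_apply x' x - a)"
        by (cases "F z'") (auto simp: a blinfun.diff_left)
    qed
    then have kx: "k x \<le> blinfun_apply x' x - a" by simp
    \<comment> \<open>Fenchel--Young for \<open>x'\<close> at \<open>x - v\<close> and for
      \<open>y'\<close> at \<open>x + v\<close>, added and combined with \<open>mid\<close>. The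
      supremum over \<open>v\<close> of the left side is then a conjugate of a power of the
      norm.\<close>
    have "blinfun_apply (y' - x') v - K * norm v powr p \<le> b - a - blinfun_apply (y' - x') x" for v
    proof -
      have "blinfun_apply x' (x - v) - k (x - v) \<le> a" using FY[of x' "x - v"] by (simp add: a)
      moreover have "blinfun_apply y' (x + v) - k (x + v) \<le> b" using FY[of y' "x + v"] by (simp add: b)
      ultimately show ?thesis using mid[of x v] kx
        by (simp add: blinfun.diff_left blinfun.diff_right blinfun.add_right)
    qed
    moreover have "1 / (p * \<delta>) = K" using p K by (simp add: \<delta>_def)
    ultimately have "convex_conjugate (\<lambda>z. ereal (1 / (p * \<delta>) * norm z powr p)) (y' - x')
        \<le> ereal (b - a - blinfun_apply (y' - x') x)"
      unfolding convex_conjugate_def by (intro SUP_least) simp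
    then show ?thesis unfolding conjugate_power_norm[OF p \<delta>] by (simp add: phi_def c_def)
  qed
  \<comment> \<open>The two strong convexity estimates with exchanged roles are added, so that
    \<open>a\<close> and \<open>b\<close> cancel.\<close>
  have "2 * c * norm (x' - y') powr q \<le> blinfun_apply (x' - y') (x - y)"
    if xy: "x \<in> dual_subdifferential F x'" "y \<in> dual_subdifferential F y'" for x y x' y'
  proof -
    obtain a b where "F x' = ereal a" "F y' = ereal b" using fin xy by metis
    with strong[OF xy(1)] strong[OF xy(2)]
    have "c * norm (y' - x') powr q \<le> b - a - blinfun_apply (y' - x') x"
      "c * norm (x' - y') powr q \<le> a - b - blinfun_apply (x' - y') y" by blast+
    then show ?thesis
      by (simp add: norm_minus_commute[of y' x'] blinfun.diff_left blinfun.diff_right)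
  qed
  then show ?thesis
    unfolding strongly_monotone_def F_def[symmetric] using \<open>c > 0\<close> by (intro exI[of _ "2 * c"]) auto
qed

lemma strongly_monotone_conjugate_moreau_yosida:
  fixes g :: "'a::real_normed_vector \<Rightarrow> ereal"
  assumes smooth: "p_smooth_space TYPE('a) p" "p \<le> 2"
    and p: "1 < p" "1 / p + 1 / q = 1" and \<epsilon>: "\<epsilon> > 0" and g: "g \<in> Gamma0"
  shows "strongly_monotone q (dual_subdifferential (convex_conjugate (moreau_yosida p \<epsilon> g)))"
proof -
  obtain K where K: "K > 0"
    "\<And>u v :: 'a. norm (u + v) powr p + norm (u - v) powr p \<le> 2 * norm u powr p + K * norm v powr p"
    using p_smooth_power_norm[OF smooth(1) p(1) smooth(2)] by blast
  obtain k where k: "\<And>x. moreau_yosida p \<epsilon> g x = ereal (k x)"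
    and sub: "\<And>x0. \<exists>x'. \<forall>x. k x0 + blinfun_apply x' (x - x0) \<le> k x"
    using moreau_yosida_real_convex[OF p \<epsilon> g] by blast
  define h where "h = (\<lambda>z::'a. 1 / (p * \<epsilon>) * norm z powr p)"
  define K' where "K' = K / (p * \<epsilon>)"
  have h: "h (u + v) + h (u - v) \<le> 2 * h u + K' * norm v powr p" for u v
  proof -
    have "1 / (p * \<epsilon>) * (norm (u + v) powr p + norm (u - v) powr p) \<le>
        1 / (p * \<epsilon>) * (2 * norm u powr p + K * norm v powr p)"
      using p \<epsilon> K(2) by (intro mult_left_mono) auto
    then show ?thesis by (simp add: h_def K'_def add_divide_distrib)
  qed
  have "K' > 0" using K p \<epsilon> by (simp add: K'_def)
  moreover have "k (x + v) + k (x - v) \<le> 2 * k x + K' * norm v powr p" for x v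
  proof (rule inf_conv_midpoint[OF _ _ h])
    show "g y \<noteq> -\<infinity>" for y using g by (simp add: Gamma0_def)
    show "inf_conv g h x = ereal (k x)" for x using k[of x] by (simp add: moreau_yosida_eq_inf_conv h_def)
  qed
  ultimately have "strongly_monotone q (dual_subdifferential (convex_conjugate (\<lambda>x. ereal (k x))))"
    by (intro strongly_monotone_conjugate[OF p _ biconjugate_real_convex[OF sub]])
  moreover have "moreau_yosida p \<epsilon> g = (\<lambda>x. ereal (k x))" using k by (simp add: fun_eq_iff)
  ultimately show ?thesis by simp
qed

theorem mainTheorem1:
  fixes f g :: "'a::banach \<Rightarrow> ereal"
    and p q \<epsilon> :: real
  assumes "strictly_convex_space TYPE('a)"
    and "smooth_space TYPE('a)"
    and "1 < p" and "1 / p + 1 / q = 1"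
    and "\<epsilon> > 0"
    and "f \<in> Gamma0" and "g \<in> Gamma0"
  shows "((\<forall>x. f x = moreau_yosida p \<epsilon> g x) \<longleftrightarrow>
          (\<forall>x'. convex_conjugate f x' =
             convex_conjugate g x' + ereal (\<epsilon> powr (q - 1) * phi q x'))) \<and>
         (p_smooth_space TYPE('a) p \<and> p \<le> 2 \<longrightarrow>
          (\<forall>x. f x = moreau_yosida p \<epsilon> g x) \<longrightarrow>
          strongly_monotone q (dual_subdifferential (convex_conjugate f)))"
proof (intro conjI impI)
  show "(\<forall>x. f x = moreau_yosida p \<epsilon> g x) \<longleftrightarrow>
      (\<forall>x'. convex_conjugate f x' = convex_conjugate g x' + ereal (\<epsilon> powr (q - 1) * phi q x'))"
    by (rule moreau_yosida_iff_conjugate) fact+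
next
  assume smooth: "p_smooth_space TYPE('a) p \<and> p \<le> 2" and "\<forall>x. f x = moreau_yosida p \<epsilon> g x"
  then have "f = moreau_yosida p \<epsilon> g" by (simp add: fun_eq_iff)
  with smooth show "strongly_monotone q (dual_subdifferential (convex_conjugate f))"
    using strongly_monotone_conjugate_moreau_yosida[OF _ _ assms(3-5,7)] by blast
qed

end
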